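(* For every $n=1,2,\dots$, $$0<\eta_n\leq\frac{\Gamma(n)}{n}.$$
   Context: For $n=0,1,2,\dots$, $\eta_n:=\int_0^{\infty}\frac{t^n}{(1+t)^2}e^{-t}\,dt$. $\Gamma$ is the Gamma function. *)

theory Defs
  imports "HOL-Analysis.Analysis"
begin

definition eta :: "nat \<Rightarrow> real" where
  "eta n = integral {0..} (\<lambda>t::real. t ^ n / (1 + t)\<^sup>2 * exp (- t))"

end

theory Submission
  imports Defs
begin

text \<open>
  Write $n = m + 1$. Integrating by parts, $\eta_n = (n + 1) \int_0^\infty \frac{t^{n-1}}{1+t} e^{-t}\,dt - \Gamma(n)$,
  and convexity of the square gives $\frac{1}{1+t} \le \frac{1}{n^2} + \frac{(n-1)^2}{n^2 t}$ with equality
  at $t = n - 1$. The resulting bound integrates to exactly $\Gamma(n)/n$, where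
  $m \int_0^\infty t^{m-1} e^{-t}\,dt = \int_0^\infty t^m e^{-t}\,dt$ (for $m \ge 1$) is a second
  integration by parts. Both integrations by parts are merged into one antiderivative $H$ on $[0, k]$
  with $H(0) = 0$ and $H(k) \le k^m e^{-k}$; the claim follows as $k \to \infty$.
\<close>

lemma power_exp_has_integral_Gamma:
  "((\<lambda>t::real. t ^ m * exp (- t)) has_integral Gamma (real (Suc m))) {0..}"
\<comment> \<open>For \<open>m = 0\<close> the integrands differ at the origin, since
  \<open>0 powr 0 = 0\<close> but \<open>0 ^ 0 = 1\<close>; one point does not affect the
  integral.\<close>
proof (rule has_integral_spike[where S = "{0}"])
  show "((\<lambda>t::real. t powr (real (Suc m) - 1) / exp t) has_integral Gamma (real (Suc m))) {0..}"
    by (rule Gamma_integral_real) simp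
qed (auto simp: powr_realpow exp_minus field_simps)

text \<open>This is H with n = m + 1. Its coefficient (n + 1)(n - 1)/n^2 is the weight of m t^(m-1)
  after the convexity bound is multiplied by (n + 1) t^m; the subtracted quotient is the boundary
  term of the first integration by parts.\<close>

definition eta_primitive :: "nat \<Rightarrow> real \<Rightarrow> real" where
  "eta_primitive m t =
     real (m * (m + 2)) / (real (m + 1))\<^sup>2 * (t ^ m * exp (- t)) - t ^ Suc m * exp (- t) / (1 + t)"

text \<open>The last fraction stands alone because it is the integrand of \<open>eta (Suc m)\<close>
  and cancels in the comparison. At \<open>m = 0\<close> the truncated exponent \<open>m - 1\<close>
  is harmless, its factor \<open>real m\<close> being 0.\<close>

definition eta_primitive_deriv :: "nat \<Rightarrow> real \<Rightarrow> real" where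
  "eta_primitive_deriv m t =
     (real (m * (m + 2)) / (real (m + 1))\<^sup>2 * (real m * t ^ (m - 1) - t ^ m)
       - (real (m + 1) * t ^ m / (1 + t) - t ^ Suc m / (1 + t) - t ^ Suc m / (1 + t)\<^sup>2)) * exp (- t)"

lemma eta_primitive_has_derivative:
  assumes "t \<ge> 0"
  shows "(eta_primitive m has_real_derivative eta_primitive_deriv m t) (at t within A)"
proof -
  have "((\<lambda>t. c * (t ^ m * exp (- t)) - t ^ Suc m * exp (- t) / (1 + t)) has_real_derivative
      (c * (real m * t ^ (m - 1) - t ^ m)
       - (real (m + 1) * t ^ m / (1 + t) - t ^ Suc m / (1 + t) - t ^ Suc m / (1 + t)\<^sup>2)) * exp (- t))
      (at t within A)" for c
  proof -
    have quot: "((\<lambda>t. t ^ Suc m / (1 + t)) has_real_derivative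
        real (m + 1) * t ^ m / (1 + t) - t ^ Suc m / (1 + t)\<^sup>2) (at t within A)"
      using assms
      by (auto intro!: derivative_eq_intros simp del: power_Suc of_nat_Suc
            simp: diff_divide_distrib power2_eq_square)
    have "((\<lambda>t. (c * t ^ m - t ^ Suc m / (1 + t)) * exp (- t)) has_real_derivative
        (c * (real m * t ^ (m - 1))
          - (real (m + 1) * t ^ m / (1 + t) - t ^ Suc m / (1 + t)\<^sup>2)) * exp (- t)
        - (c * t ^ m - t ^ Suc m / (1 + t)) * exp (- t)) (at t within A)"
      by (rule derivative_eq_intros quot refl)+ simp
    then show ?thesis
      by (simp add: algebra_simps del: power_Suc of_nat_Suc)
  qed
  then show ?thesis
    unfolding eta_primitive_def[abs_def] eta_primitive_deriv_def .
qed

lemma eta_integrand_le: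
  assumes "t \<ge> (0::real)"
  shows "t ^ Suc m / (1 + t)\<^sup>2 * exp (- t)
           \<le> eta_primitive_deriv m t + t ^ m * exp (- t) / real (Suc m)"
proof -
  define c where "c = real (m * (m + 2)) / (real (m + 1))\<^sup>2"
  have "0 \<le> c * (real m * t ^ (m - 1) - t ^ m)
          - (real (m + 1) * t ^ m / (1 + t) - t ^ Suc m / (1 + t)) + t ^ m / real (Suc m)"
  proof (cases m)
    \<comment> \<open>No factor t^(m-1) can be split off here; \<open>c\<close> is 0 and the
      expression is 2t/(1 + t).\<close>
    case 0
    then show ?thesis using assms by (simp add: c_def field_simps)
  next
    case (Suc j)
    \<comment> \<open>With t^(m-1) split off, what remains is the slack of the convexity bound times
      (m + 2) t, hence a square vanishing at t = m.\<close>
    have "c * (real m - t) - (real m + 1) * t / (1 + t) + t\<^sup>2 / (1 + t) + t / (real m + 1)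
            = (real m - t)\<^sup>2 * (real m + 2) / ((1 + t) * (real m + 1)\<^sup>2)"
      using assms by (simp add: c_def divide_simps) algebra
    then have "0 \<le> t ^ j * (c * (real m - t) - (real m + 1) * t / (1 + t) + t\<^sup>2 / (1 + t) + t / (real m + 1))"
      using assms by simp
    also have "\<dots> = c * (real m * t ^ (m - 1) - t ^ m)
          - (real (m + 1) * t ^ m / (1 + t) - t ^ Suc m / (1 + t)) + t ^ m / real (Suc m)"
      unfolding Suc by (simp add: algebra_simps power2_eq_square)
    finally show ?thesis .
  qed
  then have "0 \<le> (c * (real m * t ^ (m - 1) - t ^ m)
          - (real (m + 1) * t ^ m / (1 + t) - t ^ Suc m / (1 + t)) + t ^ m / real (Suc m)) * exp (- t)"
    by simp
  then show ?thesis
    unfolding eta_primitive_deriv_def c_def[symmetric] by (simp add: algebra_simps)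
qed

lemma eta_primitive_le:
  assumes "t \<ge> 0"
  shows "eta_primitive m t - eta_primitive m 0 \<le> t ^ m / exp t"
proof -
  have "real (m * (m + 2)) / (real (m + 1))\<^sup>2 \<le> 1"
    by (intro divide_le_eq_1_pos[THEN iffD2])
      (simp_all only: of_nat_mult of_nat_add power2_eq_square, simp_all add: algebra_simps add_pos_nonneg)
  then have "real (m * (m + 2)) / (real (m + 1))\<^sup>2 * (t ^ m * exp (- t)) \<le> 1 * (t ^ m * exp (- t))"
    using assms by (intro mult_right_mono) auto
  moreover have "0 \<le> t ^ Suc m * exp (- t) / (1 + t)"
    using assms by simp
  \<comment> \<open>For \<open>m = 0\<close> it is the coefficient, not the power, that kills the
    first term.\<close>
  moreover have "eta_primitive m 0 = 0"
    by (cases m) (auto simp: eta_primitive_def)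
  ultimately show ?thesis
    unfolding eta_primitive_def[of m t] by (simp add: exp_minus divide_inverse)
qed

lemma eta_integrand_continuous_on:
  "A \<subseteq> {0..} \<Longrightarrow> continuous_on A (\<lambda>t::real. t ^ n / (1 + t)\<^sup>2 * exp (- t))"
  by (force intro!: continuous_intros)

text \<open>Integrating the pointwise bound over a bounded interval lets the fundamental theorem
  evaluate H; the boundary contribution stays explicit until the limit.\<close>

lemma eta_truncated_le:
  assumes "b \<ge> 0"
  shows "integral {0..b} (\<lambda>t::real. t ^ Suc m / (1 + t)\<^sup>2 * exp (- t))
           \<le> b ^ m / exp b + Gamma (real (Suc m)) / real (Suc m)"
proof -
  have H: "(eta_primitive_deriv m has_integral eta_primitive m b - eta_primitive m 0) {0..b}"
    by (rule fundamental_theorem_of_calculus)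
       (use assms in \<open>auto intro!: eta_primitive_has_derivative
          simp flip: has_real_derivative_iff_has_vector_derivative\<close>)
  have P: "(\<lambda>t::real. t ^ m * exp (- t)) integrable_on {0..b}"
    by (intro integrable_continuous_interval continuous_intros)
  have le: "integral {0..b} (\<lambda>t::real. t ^ m * exp (- t)) \<le> Gamma (real (Suc m))"
    unfolding integral_unique[OF power_exp_has_integral_Gamma, symmetric]
    by (rule integral_subset_le[OF _ P has_integral_integrable[OF power_exp_has_integral_Gamma]]) auto
  have "integral {0..b} (\<lambda>t::real. t ^ Suc m / (1 + t)\<^sup>2 * exp (- t))
      \<le> eta_primitive m b - eta_primitive m 0
         + integral {0..b} (\<lambda>t::real. t ^ m * exp (- t)) / real (Suc m)"
  proof (rule has_integral_le)
    show "((\<lambda>t::real. t ^ Suc m / (1 + t)\<^sup>2 * exp (- t)) has_integral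
        integral {0..b} (\<lambda>t::real. t ^ Suc m / (1 + t)\<^sup>2 * exp (- t))) {0..b}"
      by (intro integrable_integral integrable_continuous_interval eta_integrand_continuous_on) auto
    show "((\<lambda>t. eta_primitive_deriv m t + t ^ m * exp (- t) / real (Suc m)) has_integral
        eta_primitive m b - eta_primitive m 0
         + integral {0..b} (\<lambda>t::real. t ^ m * exp (- t)) / real (Suc m)) {0..b}"
      by (intro has_integral_add H has_integral_divide integrable_integral P)
  qed (rule eta_integrand_le, simp)
  also have "\<dots> \<le> b ^ m / exp b + Gamma (real (Suc m)) / real (Suc m)"
    using le eta_primitive_le[OF assms] by (intro add_mono divide_right_mono) auto
  finally show ?thesis .
qed

text \<open>\<open>integral\<close> defaults to 0 on non-integrable functions, so integrability must
  be secured. Dominated convergence of the truncations, with majorant t^n exp(-t), gives it together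
  with the limit.\<close>

lemma
  shows eta_integrand_integrable:
      "(\<lambda>t::real. t ^ n / (1 + t)\<^sup>2 * exp (- t)) integrable_on {0..}"
    and eta_truncated_tendsto:
      "(\<lambda>k. integral {0..real k} (\<lambda>t::real. t ^ n / (1 + t)\<^sup>2 * exp (- t))) \<longlonglongrightarrow> eta n"
proof -
  define f where "f = (\<lambda>t::real. t ^ n / (1 + t)\<^sup>2 * exp (- t))"
  define g where "g = (\<lambda>k t. if t \<in> {0..real k} then f t else 0)"
  have cut: "{0..real k} \<inter> {0..} = {0..real k}" for k
    by auto
  have int: "f integrable_on {0..real k}" for k
    unfolding f_def by (intro integrable_continuous_interval eta_integrand_continuous_on) auto
  have g_int: "g k integrable_on {0..}" for k
    using integrable_restrict_Int[of "{0..real k}" f "{0..}"] int[of k] by (simp only: g_def cut)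
  have g_eq: "integral {0..} (g k) = integral {0..real k} f" for k
    using integral_restrict_Int[of "{0..}" "{0..real k}" f] by (simp only: g_def cut)
  have le: "norm (g k t) \<le> t ^ n * exp (- t)" if "t \<in> {0..}" for k t
  proof -
    have "t ^ n * exp (- t) / (1 + t)\<^sup>2 \<le> t ^ n * exp (- t) / 1"
      using that by (intro divide_left_mono one_le_power) auto
    then show ?thesis
      using that by (auto simp: g_def f_def)
  qed
  have conv: "(\<lambda>k. g k t) \<longlonglongrightarrow> f t" if "t \<in> {0..}" for t
  proof (rule tendsto_eventually)
    \<comment> \<open>At a fixed t the truncation is inactive once k \<ge> t.\<close>
    show "\<forall>\<^sub>F k in sequentially. g k t = f t"
      using eventually_ge_at_top[of "nat \<lceil>t\<rceil>"]
      by eventually_elim (use that in \<open>auto simp: g_def nat_le_iff ceiling_le_iff\<close>)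
  qed
  note dom = dominated_convergence[OF g_int has_integral_integrable[OF power_exp_has_integral_Gamma] le conv]
  show "(\<lambda>t::real. t ^ n / (1 + t)\<^sup>2 * exp (- t)) integrable_on {0..}"
    using dom(1) unfolding f_def .
  show "(\<lambda>k. integral {0..real k} (\<lambda>t::real. t ^ n / (1 + t)\<^sup>2 * exp (- t))) \<longlonglongrightarrow> eta n"
    using dom(2) unfolding g_eq unfolding f_def eta_def .
qed

text \<open>On [1, 2] the integrand is at least exp(-2)/9 for every n, because t^n \<ge> 1 there;
  the rest of the half-line contributes nonnegatively.\<close>

lemma eta_pos: "0 < eta n"
proof -
  have int: "(\<lambda>t::real. t ^ n / (1 + t)\<^sup>2 * exp (- t)) integrable_on {1..2}"
    by (intro integrable_continuous_interval eta_integrand_continuous_on) auto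
  have "0 < integral {1..2} (\<lambda>t::real. exp (- 2) / 9 :: real)"
    by simp
  also have "\<dots> \<le> integral {1..2} (\<lambda>t::real. t ^ n / (1 + t)\<^sup>2 * exp (- t))"
  proof (rule integral_le[OF _ int])
    fix t :: real assume t: "t \<in> {1..2}"
    have "(1 + t)\<^sup>2 \<le> 3\<^sup>2"
      using t by (intro power_mono) auto
    then have "1 / 9 * exp (- 2) \<le> t ^ n / (1 + t)\<^sup>2 * exp (- t)"
      using t by (intro mult_mono frac_le) (auto simp: one_le_power)
    then show "exp (- 2) / 9 \<le> t ^ n / (1 + t)\<^sup>2 * exp (- t)" by simp
  qed (rule integrable_continuous_interval, simp)
  also have "\<dots> \<le> eta n"
    unfolding eta_def by (rule integral_subset_le[OF _ int eta_integrand_integrable]) auto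
  finally show ?thesis .
qed

theorem proposition3p18:
  fixes n :: nat
  assumes "n \<ge> 1"
  shows "0 < eta n \<and> eta n \<le> Gamma (real n) / real n"
proof
  show "0 < eta n" by (rule eta_pos)
  obtain m where n: "n = Suc m" using assms by (cases n) auto
  have "(\<lambda>k. real k ^ m / exp (real k)) \<longlonglongrightarrow> 0"
    by (rule filterlim_compose[OF tendsto_power_div_exp_0 filterlim_real_sequentially])
  then have "(\<lambda>k. real k ^ m / exp (real k) + Gamma (real n) / real n) \<longlonglongrightarrow> Gamma (real n) / real n"
    using tendsto_add[OF _ tendsto_const] by force
  then show "eta n \<le> Gamma (real n) / real n"
    by (rule LIMSEQ_le[OF eta_truncated_tendsto])
       (use eta_truncated_le[of "real _" m] in \<open>auto simp: n simp del: of_nat_Suc power_Suc\<close>)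
qed

end
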